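(* For $m,n\geq2$ and $d\geq0$, the number of Fibonacci polyominoes $P\in\mathcal F_{m,n}$ with $\operatorname{des}(P)=d$ equals \[ N(m,d+1)\binom{n-2}{m-1}+N(m-1,d)\binom{n-2}{m-2}. \] For $m=1$, the unique polyomino in $\mathcal F_{1,n}$ has no descents.
   Context: A Fibonacci polyomino is a (nonempty) polyomino, considered up to translation, that is column-convex (each column is a contiguous segment of unit cells) and such that, reading columns from left to right, the bottom cell of each column lies exactly one unit above the bottom cell of the preceding column. Equivalently, it is given by a sequence of column heights $(h_1,\dots,h_m)$, $m\ge 1$, with $h_i\ge 2$ for $1\le i\le m-1$ and $h_m\ge 1$; column $i$ consists of the cells in column position $i$ and rows $i,i+1,\dots,i+h_i-1$. The horizontal (resp. vertical) semiperimeter is half the number of horizontal (resp. vertical) unit edges on the boundary (edges belonging to exactly one cell). $\mathcal F_{m,n}$ is the set of Fibonacci polyominoes with horizontal semiperimeter $m$ (equivalently $m$ columns) and vertical semiperimeter $n$. For $P$ with column heights $(h_1,\ldots,h_m)$, the number of descents is $\operatorname{des}(P)=|\{i:1\le i<m,\ h_i>h_{i+1}\}|$. Narayana numbers: $N(\ell,k)=\frac1\ell\binom{\ell}{k}\binom{\ell}{k-1}$ for $1\le k\le\ell$, and $N(\ell,k)=0$ outside this range. Binomial coefficients $\binom ab$ with $a\ge0$ vanish if $b<0$ or $b>a$. *)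

theory Defs
  imports Complex_Main "HOL-Library.Product_Plus"
begin

text \<open>A cell \<open>(x, y)\<close> stands for the unit square \<open>[x, x+1] \<times> [y, y+1]\<close>.\<close>

type_synonym cell = "int \<times> int"

definition adjacent :: "cell \<Rightarrow> cell \<Rightarrow> bool" where
  "adjacent c c' \<longleftrightarrow> \<bar>fst c - fst c'\<bar> + \<bar>snd c - snd c'\<bar> = 1"

definition edge_connected :: "cell set \<Rightarrow> bool" where
  "edge_connected S \<longleftrightarrow>
     (\<forall>c\<in>S. \<forall>c'\<in>S. (c, c') \<in> {(a, b). a \<in> S \<and> b \<in> S \<and> adjacent a b}\<^sup>*)"

definition polyomino_cells :: "cell set \<Rightarrow> bool" where
  "polyomino_cells S \<longleftrightarrow> finite S \<and> S \<noteq> {} \<and> edge_connected S"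

definition column :: "cell set \<Rightarrow> int \<Rightarrow> int set" where
  "column S x = {y. (x, y) \<in> S}"

definition column_convex_cells :: "cell set \<Rightarrow> bool" where
  "column_convex_cells S \<longleftrightarrow> (\<forall>x. \<exists>a b. column S x = {a..b})"

definition rising_bottoms_cells :: "cell set \<Rightarrow> bool" where
  "rising_bottoms_cells S \<longleftrightarrow>
     (\<forall>x. column S x \<noteq> {} \<and> column S (x + 1) \<noteq> {} \<longrightarrow>
        Min (column S (x + 1)) = Min (column S x) + 1)"

text \<open>A horizontal edge is represented by its left endpoint, a vertical edge by its lower endpoint.\<close>

definition horizontal_edges :: "cell \<Rightarrow> (int \<times> int) set" where
  "horizontal_edges c = {(fst c, snd c), (fst c, snd c + 1)}"

definition vertical_edges :: "cell \<Rightarrow> (int \<times> int) set" where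
  "vertical_edges c = {(fst c, snd c), (fst c + 1, snd c)}"

definition hsemi_cells :: "cell set \<Rightarrow> real" where
  "hsemi_cells S = real (card {e. \<exists>!c. c \<in> S \<and> e \<in> horizontal_edges c}) / 2"

definition vsemi_cells :: "cell set \<Rightarrow> real" where
  "vsemi_cells S = real (card {e. \<exists>!c. c \<in> S \<and> e \<in> vertical_edges c}) / 2"

text \<open>Columns are numbered \<open>1, 2, \<dots>\<close> from the leftmost nonempty one.\<close>

definition num_columns :: "cell set \<Rightarrow> nat" where
  "num_columns S = card (fst ` S)"

definition column_height :: "cell set \<Rightarrow> nat \<Rightarrow> nat" where
  "column_height S i = card (column S (Min (fst ` S) + int i - 1))"

definition des_cells :: "cell set \<Rightarrow> nat" where
  "des_cells S =
     card {i. 1 \<le> i \<and> i < num_columns S \<and> column_height S i > column_height S (i + 1)}"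

definition translation_equiv :: "cell set \<Rightarrow> cell set \<Rightarrow> bool" where
  "translation_equiv S T \<longleftrightarrow>
     polyomino_cells S \<and> polyomino_cells T \<and> (\<exists>v. T = (+) v ` S)"

lemma translation_equiv_part_equivp: "part_equivp translation_equiv"
proof (rule part_equivpI)
  have "polyomino_cells {(0, 0)}"
    by (simp add: polyomino_cells_def edge_connected_def)
  moreover have "{(0, 0)} = (+) (0 :: cell) ` {(0, 0)}"
    by (simp add: zero_prod_def)
  ultimately show "\<exists>S. translation_equiv S S"
    unfolding translation_equiv_def by blast
  show "symp translation_equiv"
  proof (rule sympI)
    fix S T assume *: "translation_equiv S T"
    then obtain v where "T = (+) v ` S" by (auto simp: translation_equiv_def)
    then have "S = (+) (- v) ` T" by (simp add: image_image)
    with * show "translation_equiv T S" unfolding translation_equiv_def by blast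
  qed
  show "transp translation_equiv"
  proof (rule transpI)
    fix S T U assume *: "translation_equiv S T" "translation_equiv T U"
    then obtain v w where "T = (+) v ` S" "U = (+) w ` T"
      by (auto simp: translation_equiv_def)
    then have "U = (+) (w + v) ` S" by (simp add: image_image add.assoc)
    with * show "translation_equiv S U" unfolding translation_equiv_def by blast
  qed
qed

quotient_type polyomino = "cell set" / partial: translation_equiv
  by (rule translation_equiv_part_equivp)

lemma mem_translate:
  fixes v :: cell
  shows "(x, y) \<in> (+) v ` S \<longleftrightarrow> (x - fst v, y - snd v) \<in> S"
proof
  assume "(x, y) \<in> (+) v ` S"
  then obtain c where "c \<in> S" "(x, y) = v + c" by auto
  moreover from this have "c = (x - fst v, y - snd v)" by (cases c, cases v) auto
  ultimately show "(x - fst v, y - snd v) \<in> S" by simp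
next
  assume "(x - fst v, y - snd v) \<in> S"
  moreover have "(x, y) = v + (x - fst v, y - snd v)" by (cases v) auto
  ultimately show "(x, y) \<in> (+) v ` S" by blast
qed

lemma column_translate: "column ((+) v ` S) x = (+) (snd v) ` column S (x - fst v)"
proof (intro set_eqI)
  fix y
  show "y \<in> column ((+) v ` S) x \<longleftrightarrow> y \<in> (+) (snd v) ` column S (x - fst v)"
    unfolding column_def mem_Collect_eq mem_translate
    by (auto simp: image_iff intro!: exI[of _ "y - snd v"])
qed

lemma card_column_translate: "card (column ((+) v ` S) x) = card (column S (x - fst v))"
  by (simp add: column_translate card_image)

lemma finite_column: "finite S \<Longrightarrow> finite (column S x)"
proof -
  assume "finite S"
  moreover have "column S x \<subseteq> snd ` S" by (force simp: column_def)
  ultimately show ?thesis using finite_surj by blast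
qed

lemma Min_translate:
  "finite A \<Longrightarrow> A \<noteq> {} \<Longrightarrow> Min ((+) (a :: int) ` A) = a + Min A"
  by (rule mono_Min_commute[symmetric]) (auto simp: mono_def)

lemma column_convex_translate:
  assumes "column_convex_cells S" shows "column_convex_cells ((+) v ` S)"
  unfolding column_convex_cells_def
proof
  fix x
  obtain a b where "column S (x - fst v) = {a..b}"
    using assms unfolding column_convex_cells_def by blast
  then have "column ((+) v ` S) x = {snd v + a..snd v + b}"
    by (simp add: column_translate)
  then show "\<exists>a b. column ((+) v ` S) x = {a..b}" by blast
qed

lemma rising_bottoms_translate:
  assumes "finite S" "rising_bottoms_cells S" shows "rising_bottoms_cells ((+) v ` S)"
  unfolding rising_bottoms_cells_def
proof (intro allI impI)
  fix x
  assume *: "column ((+) v ` S) x \<noteq> {} \<and> column ((+) v ` S) (x + 1) \<noteq> {}"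
  have eq: "x + 1 - fst v = (x - fst v) + 1" by simp
  from * have ne: "column S (x - fst v) \<noteq> {}" "column S (x - fst v + 1) \<noteq> {}"
    by (simp_all add: column_translate eq)
  then have "Min (column S (x - fst v + 1)) = Min (column S (x - fst v)) + 1"
    using assms(2) by (auto simp: rising_bottoms_cells_def)
  then show "Min (column ((+) v ` S) (x + 1)) = Min (column ((+) v ` S) x) + 1"
    using ne assms(1) by (simp add: column_translate eq Min_translate finite_column)
qed

lemma card_unique_translate:
  assumes E: "\<And>c. E (v + c) = (+) v ` E c"
  shows "card {e. \<exists>!c. c \<in> (+) v ` S \<and> e \<in> E c} = card {e :: cell. \<exists>!c :: cell. c \<in> S \<and> e \<in> E c}"
proof -
  have iff: "(\<exists>!c. c \<in> (+) v ` S \<and> v + e \<in> E c) \<longleftrightarrow> (\<exists>!c. c \<in> S \<and> e \<in> E c)" for e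
  proof -
    have 1: "v + c \<in> (+) v ` S \<and> v + e \<in> E (v + c) \<longleftrightarrow> c \<in> S \<and> e \<in> E c" for c
      by (auto simp: E)
    have "(\<exists>!c. Q c) \<longleftrightarrow> (\<exists>!c. Q (v + c))" for Q :: "cell \<Rightarrow> bool"
      by (metis add_diff_cancel_left' diff_add_cancel add.commute)
    from this[of "\<lambda>c. c \<in> (+) v ` S \<and> v + e \<in> E c"] show ?thesis by (simp only: 1)
  qed
  have "{e. \<exists>!c. c \<in> (+) v ` S \<and> e \<in> E c} = (+) v ` {e. \<exists>!c. c \<in> S \<and> e \<in> E c}"
  proof (intro set_eqI)
    fix e
    have "e = v + (e - v)" by simp
    then show "e \<in> {e. \<exists>!c. c \<in> (+) v ` S \<and> e \<in> E c} \<longleftrightarrow> e \<in> (+) v ` {e. \<exists>!c. c \<in> S \<and> e \<in> E c}"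
      using iff[of "e - v"] by (smt (verit) add_left_cancel imageE image_eqI mem_Collect_eq)
  qed
  then show ?thesis by (simp add: card_image)
qed

lemma hsemi_translate: "hsemi_cells ((+) v ` S) = hsemi_cells S"
  unfolding hsemi_cells_def
  by (subst card_unique_translate) (auto simp: horizontal_edges_def prod_eq_iff)

lemma vsemi_translate: "vsemi_cells ((+) v ` S) = vsemi_cells S"
  unfolding vsemi_cells_def
  by (subst card_unique_translate) (auto simp: vertical_edges_def prod_eq_iff)

lemma des_translate:
  assumes "finite S" "S \<noteq> {}" shows "des_cells ((+) v ` S) = des_cells S"
proof -
  have f: "fst ` (+) v ` S = (+) (fst v) ` fst ` S"
    by (simp add: image_image)
  have "num_columns ((+) v ` S) = num_columns S"
    by (simp only: num_columns_def f) (simp add: card_image)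
  moreover have "Min (fst ` (+) v ` S) = fst v + Min (fst ` S)"
    unfolding f using assms by (intro Min_translate) auto
  then have "column_height ((+) v ` S) i = column_height S i" for i
    unfolding column_height_def card_column_translate
    by (intro arg_cong[where f = "\<lambda>x. card (column S x)"]) simp
  ultimately show ?thesis by (simp add: des_cells_def)
qed

lift_definition column_convex :: "polyomino \<Rightarrow> bool" is column_convex_cells
proof -
  fix S T assume "translation_equiv S T"
  moreover from this have "translation_equiv T S"
    using translation_equiv_part_equivp by (meson part_equivp_symp)
  ultimately show "column_convex_cells S = column_convex_cells T"
    unfolding translation_equiv_def using column_convex_translate by metis
qed

lift_definition rising_bottoms :: "polyomino \<Rightarrow> bool" is rising_bottoms_cells
proof -
  fix S T assume "translation_equiv S T"
  moreover from this have "translation_equiv T S"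
    using translation_equiv_part_equivp by (meson part_equivp_symp)
  ultimately show "rising_bottoms_cells S = rising_bottoms_cells T"
    unfolding translation_equiv_def polyomino_cells_def
    using rising_bottoms_translate by metis
qed

lift_definition hsemiperimeter :: "polyomino \<Rightarrow> real" is hsemi_cells
  by (auto simp: translation_equiv_def hsemi_translate)

lift_definition vsemiperimeter :: "polyomino \<Rightarrow> real" is vsemi_cells
  by (auto simp: translation_equiv_def vsemi_translate)

lift_definition des :: "polyomino \<Rightarrow> nat" is des_cells
  unfolding translation_equiv_def polyomino_cells_def using des_translate by metis

definition fibonacci_polyomino :: "polyomino \<Rightarrow> bool" where
  "fibonacci_polyomino P \<longleftrightarrow> column_convex P \<and> rising_bottoms P"

definition fibonacci_polyominoes :: "nat \<Rightarrow> nat \<Rightarrow> polyomino set" where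
  "fibonacci_polyominoes m n =
     {P. fibonacci_polyomino P \<and> hsemiperimeter P = real m \<and> vsemiperimeter P = real n}"

definition narayana :: "nat \<Rightarrow> nat \<Rightarrow> real" where
  "narayana l k =
     (if 1 \<le> k \<and> k \<le> l then 1 / real l * real (l choose k) * real (l choose (k - 1)) else 0)"

end

theory Submission
  imports Defs
begin

text \<open>
  A Fibonacci polyomino is determined by its list of column heights. Between columns of heights
  \<open>a\<close> and \<open>b\<close> there are \<open>1 + \<bar>a - 1 - b\<bar>\<close> vertical boundary edges, so that the vertical
  semiperimeter telescopes to \<open>h\<^sub>1 + excess\<close>, where only the non-descents \<open>a \<le> b\<close> contribute
  to the excess, by \<open>b - a + 1\<close>.

  If every height is at least 2, subtract 2 from each of them. The number of lists of naturals with
  given numbers of descents and non-descents, first entry and excess satisfies a recurrence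
  (prepend one column) that is solved by a difference of two products of three binomial
  coefficients. Summing over the first entry gives \<open>N(m, d + 1)\<close> times a binomial coefficient.
  If the last height is 1, then deleting the last column removes one descent and keeps the vertical
  semiperimeter, and all the remaining heights are at least 2; this yields the second summand.
\<close>

section \<open>Lists with prescribed descents and excess\<close>

fun descents :: "nat list \<Rightarrow> nat" where
  "descents (a # b # xs) = (if b < a then 1 else 0) + descents (b # xs)"
| "descents _ = 0"

fun excess :: "nat list \<Rightarrow> nat" where
  "excess (a # b # xs) = (if b < a then 0 else b - a + 1) + excess (b # xs)"
| "excess _ = 0"

text \<open>The number of compositions of \<open>r\<close> into \<open>e\<close> positive parts; \<open>(r - 1) choose (e - 1)\<close> alone
  would give junk values at \<open>r = 0\<close> and \<open>e = 0\<close> because of truncated subtraction.\<close>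

fun compositions :: "nat \<Rightarrow> nat \<Rightarrow> nat" where
  "compositions 0 0 = 1"
| "compositions 0 (Suc e) = 0"
| "compositions (Suc r) 0 = 0"
| "compositions (Suc r) (Suc e) = r choose e"

text \<open>Remove the first part if it is 1, otherwise decrease it by 1. The special values at 0
  make the rule hold without side conditions.\<close>

lemma compositions_Suc_Suc:
  "compositions (Suc r) (Suc e) = compositions r e + compositions r (Suc e)"
  by (cases r; cases e) auto

text \<open>Split off the last part \<open>r - j\<close>, which is positive. This is the
  hockey-stick identity for \<open>compositions\<close>.\<close>

lemma sum_compositions: "(\<Sum>j<r. compositions j e) = compositions r (Suc e)"
  by (induction r) (auto simp: compositions_Suc_Suc simp del: compositions.simps(4))

lemma compositions_eq_0: "r < e \<Longrightarrow> compositions r e = 0"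
  by (cases r; cases e) auto

text \<open>Here \<open>d\<close> and \<open>e\<close> are the numbers of descents and of non-descents, \<open>k\<close> the first entry.\<close>

definition lists_with :: "nat \<Rightarrow> nat \<Rightarrow> nat \<Rightarrow> nat \<Rightarrow> nat list set" where
  "lists_with d e k r =
     {xs. length xs = d + e + 1 \<and> descents xs = d \<and> hd xs = k \<and> excess xs = r}"

text \<open>A closed form guessed from the recurrence for prepending an entry. With
  \<open>K = k + r - e\<close>, prepending an entry \<open>\<le> k\<close> keeps \<open>K\<close> and prepending an entry \<open>> k\<close> keeps \<open>r\<close>,
  so in each case only one factor of each product is summed, by a hockey-stick identity.\<close>

definition num_lists_with :: "nat \<Rightarrow> nat \<Rightarrow> nat \<Rightarrow> nat \<Rightarrow> int" where
  "num_lists_with d e k r =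
     int ((d + e) choose d) * int (compositions r e) * int ((k + r - e) choose d)
   - int ((d + e) choose Suc d) * int (compositions r (Suc e)) * int (compositions (k + r - e) d)"

section \<open>Recurrence by removing the first entry\<close>

lemma descents_less: "xs \<noteq> [] \<Longrightarrow> descents xs < length xs"
  by (induction xs rule: descents.induct) auto

lemma lists_with_0_0: "lists_with 0 0 k r = (if r = 0 then {[k]} else {})"
  by (auto simp: lists_with_def length_Suc_conv)

text \<open>The possible tails after a non-descent from \<open>k\<close> to \<open>b\<close>. With
  \<open>j\<close> the excess of the tail, \<open>b - k + 1 = r - j\<close> gives the first entry
  \<open>b = k + (r - 1 - j)\<close>.\<close>

definition ascend_part :: "nat \<Rightarrow> nat \<Rightarrow> nat \<Rightarrow> nat \<Rightarrow> nat list set" where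
  "ascend_part d e k r = (if e = 0 then {} else \<Union>j<r. lists_with d (e - 1) (k + (r - 1 - j)) j)"

definition descend_part :: "nat \<Rightarrow> nat \<Rightarrow> nat \<Rightarrow> nat \<Rightarrow> nat list set" where
  "descend_part d e k r = (if d = 0 then {} else \<Union>j<k. lists_with (d - 1) e j r)"

lemma lists_with_rec:
  assumes "d + e > 0"
  shows "lists_with d e k r = (#) k ` (ascend_part d e k r \<union> descend_part d e k r)"
proof (intro set_eqI iffI)
  fix xs assume "xs \<in> lists_with d e k r"
  then have xs: "length xs = d + e + 1" "descents xs = d" "hd xs = k" "excess xs = r"
    by (auto simp: lists_with_def)
  then obtain b ys where eq: "xs = k # b # ys"
    using assms by (cases xs; cases "tl xs") auto
  have len: "Suc (length ys) = d + e" using xs eq by simp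
  show "xs \<in> (#) k ` (ascend_part d e k r \<union> descend_part d e k r)"
  proof (cases "b < k")
    case True
    then have "b # ys \<in> descend_part d e k r"
      using xs eq by (auto simp: descend_part_def lists_with_def)
    then show ?thesis using eq by blast
  next
    case False
    \<comment> \<open>The tail has \<open>d + e\<close> entries and still all \<open>d\<close>
      descents, which forces \<open>e > 0\<close>.\<close>
    have "descents (b # ys) < Suc (length ys)" using descents_less[of "b # ys"] by simp
    then have "e > 0" using xs eq len False by simp
    moreover have "excess (b # ys) < r" "k + (r - 1 - excess (b # ys)) = b"
      using xs eq False by auto
    ultimately have "b # ys \<in> ascend_part d e k r"
      using xs eq False by (auto simp: ascend_part_def lists_with_def)
    then show ?thesis using eq by blast
  qed
next
  fix xs assume "xs \<in> (#) k ` (ascend_part d e k r \<union> descend_part d e k r)"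
  then obtain ys where ys: "xs = k # ys" "ys \<in> ascend_part d e k r \<or> ys \<in> descend_part d e k r"
    by auto
  then have "ys \<noteq> []"
    by (auto simp: ascend_part_def descend_part_def lists_with_def split: if_splits)
  then obtain b zs where "ys = b # zs" by (cases ys) auto
  then show "xs \<in> lists_with d e k r"
    using ys by (auto simp: ascend_part_def descend_part_def lists_with_def split: if_splits)
qed

text \<open>A list determines its first entry and its excess, so distinct pairs
  \<open>(f i, g i)\<close> give disjoint sets.\<close>

lemma card_Union_lists_with:
  assumes "\<And>i. i \<in> I \<Longrightarrow> finite (lists_with d e (f i) (g i))" "finite I"
    and "inj_on (\<lambda>i. (f i, g i)) I"
  shows "card (\<Union>i\<in>I. lists_with d e (f i) (g i)) = (\<Sum>i\<in>I. card (lists_with d e (f i) (g i)))"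
  using assms by (intro card_UN_disjoint) (auto simp: lists_with_def inj_on_def)

section \<open>The closed form satisfies the recurrence\<close>

lemma num_lists_with_ascend:
  "(\<Sum>j<r. num_lists_with d e (k + (r - 1 - j)) j) =
     int ((d + e) choose d) * int (compositions r (Suc e)) * int ((k + r - Suc e) choose d)
   - int ((d + e) choose Suc d) * int (compositions r (Suc (Suc e))) * int (compositions (k + r - Suc e) d)"
proof -
  have "num_lists_with d e (k + (r - 1 - j)) j =
     int ((d + e) choose d) * int ((k + r - Suc e) choose d) * int (compositions j e)
   - int ((d + e) choose Suc d) * int (compositions (k + r - Suc e) d) * int (compositions j (Suc e))"
    if "j < r" for j
  proof -
    have "k + (r - 1 - j) + j - e = k + r - Suc e" using that by simp
    then show ?thesis by (simp add: num_lists_with_def mult_ac)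
  qed
  then have "(\<Sum>j<r. num_lists_with d e (k + (r - 1 - j)) j) = (\<Sum>j<r.
     int ((d + e) choose d) * int ((k + r - Suc e) choose d) * int (compositions j e)
   - int ((d + e) choose Suc d) * int (compositions (k + r - Suc e) d) * int (compositions j (Suc e)))"
    by (intro sum.cong) auto
  also have "\<dots> =
     int ((d + e) choose d) * int ((k + r - Suc e) choose d) * int (\<Sum>j<r. compositions j e)
   - int ((d + e) choose Suc d) * int (compositions (k + r - Suc e) d) * int (\<Sum>j<r. compositions j (Suc e))"
    by (simp only: sum_subtractf sum_distrib_left of_nat_sum)
  finally show ?thesis by (simp only: sum_compositions mult_ac)
qed

text \<open>Telescoping: a hockey-stick sum that starts at \<open>c\<close> is a difference of two
  values, the lower one being a boundary term.\<close>

lemma sum_shift_diff: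
  fixes f F :: "nat \<Rightarrow> nat"
  assumes "\<And>n. (\<Sum>j<n. f j) = F n"
  shows "(\<Sum>j<k. int (f (j + c))) = int (F (k + c)) - int (F c)"
proof (induction k)
  case (Suc k)
  have "F (Suc n) = F n + f n" for n using assms[of n] assms[of "Suc n"] by simp
  with Suc show ?case by simp
qed simp

lemma sum_lessThan_choose: "(\<Sum>j<n. j choose d) = n choose Suc d"
  by (induction n) auto

lemma binomial_step: "(n choose Suc k) * Suc k = (n choose k) * (n - k)"
  using binomial_absorb_comp[of n k] binomial_absorption[of k n] by (simp add: mult.commute)

text \<open>The lower ends of the two sums over \<open>k\<close> in \<open>num_lists_with_descend\<close> below cancel;
  the subtracted product in \<open>num_lists_with\<close> is there to achieve this.\<close>

lemma boundary_cancel: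
  assumes "e \<le> r"
  shows "((d + e) choose d) * compositions r e * ((r - e) choose Suc d)
       = ((d + e) choose Suc d) * compositions r (Suc e) * compositions (r - e) (Suc d)"
proof (cases "e = r")
  case False
  with assms obtain s where s: "r = Suc (e + s)"
    using less_imp_Suc_add[of e r] by auto
  show ?thesis
  proof (cases e)
    case 0 then show ?thesis using s by simp
  next
    case (Suc e')
    have "((d + e) choose Suc d) * Suc d = ((d + e) choose d) * e"
      using binomial_step[of "d + e" d] by simp
    moreover have "((e + s) choose e) * e = ((e + s) choose e') * Suc s"
      using binomial_step[of "e + s" e'] Suc by simp
    moreover have "(Suc s choose Suc d) * Suc d = Suc s * (s choose d)"
      using binomial_absorption[of d "Suc s"] by (simp add: mult.commute)
    \<comment> \<open>Multiplying by \<open>Suc d * e\<close> clears the denominators of the three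
      ratios of neighbouring binomials. The factor is nonzero because
      \<open>e = Suc e'\<close>.\<close>
    ultimately have "(((d + e) choose d) * ((e + s) choose e') * (Suc s choose Suc d)) * (Suc d * e)
       = (((d + e) choose Suc d) * ((e + s) choose e) * (s choose d)) * (Suc d * e)"
      by algebra
    then have "((d + e) choose d) * ((e + s) choose e') * (Suc s choose Suc d)
       = ((d + e) choose Suc d) * ((e + s) choose e) * (s choose d)"
      using Suc by (metis mult_cancel2 mult_is_0 nat.distinct(1))
    moreover have "compositions r e = (e + s) choose e'" "compositions r (Suc e) = (e + s) choose e"
      "compositions (r - e) (Suc d) = s choose d" "r - e = Suc s"
      using s Suc by simp_all
    ultimately show ?thesis by metis
  qed
qed simp

lemma num_lists_with_descend:
  "(\<Sum>j<k. num_lists_with d e j r) =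
     int ((d + e) choose d) * int (compositions r e) * int ((k + r - e) choose Suc d)
   - int ((d + e) choose Suc d) * int (compositions r (Suc e)) * int (compositions (k + r - e) (Suc d))"
\<comment> \<open>For \<open>e \<le> r\<close> the truncated \<open>j + r - e\<close> is the shift
  \<open>j + (r - e)\<close>; otherwise \<open>compositions r e\<close> and
  \<open>compositions r (Suc e)\<close> vanish.\<close>
proof (cases "e \<le> r")
  case True
  then have "num_lists_with d e j r =
     int ((d + e) choose d) * int (compositions r e) * int ((j + (r - e)) choose d)
   - int ((d + e) choose Suc d) * int (compositions r (Suc e)) * int (compositions (j + (r - e)) d)" for j
    by (simp add: num_lists_with_def)
  then have "(\<Sum>j<k. num_lists_with d e j r) =
     int ((d + e) choose d) * int (compositions r e) * (\<Sum>j<k. int ((j + (r - e)) choose d))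
   - int ((d + e) choose Suc d) * int (compositions r (Suc e)) * (\<Sum>j<k. int (compositions (j + (r - e)) d))"
    by (simp only: sum_subtractf sum_distrib_left)
  also have "\<dots> =
     int ((d + e) choose d) * int (compositions r e) * (int ((k + (r - e)) choose Suc d) - int ((r - e) choose Suc d))
   - int ((d + e) choose Suc d) * int (compositions r (Suc e)) * (int (compositions (k + (r - e)) (Suc d)) - int (compositions (r - e) (Suc d)))"
    by (simp only: sum_shift_diff[OF sum_lessThan_choose] sum_shift_diff[OF sum_compositions])
  also have "\<dots> = int ((d + e) choose d) * int (compositions r e) * int ((k + (r - e)) choose Suc d)
   - int ((d + e) choose Suc d) * int (compositions r (Suc e)) * int (compositions (k + (r - e)) (Suc d))
   + (int ((d + e) choose Suc d) * int (compositions r (Suc e)) * int (compositions (r - e) (Suc d))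
      - int ((d + e) choose d) * int (compositions r e) * int ((r - e) choose Suc d))"
    by (simp only: algebra_simps)
  also have "int ((d + e) choose Suc d) * int (compositions r (Suc e)) * int (compositions (r - e) (Suc d))
      - int ((d + e) choose d) * int (compositions r e) * int ((r - e) choose Suc d) = 0"
    using boundary_cancel[OF True, of d] by (simp flip: of_nat_mult)
  finally show ?thesis using True by simp
qed (simp add: num_lists_with_def compositions_eq_0)

text \<open>If \<open>d\<close> and \<open>e\<close> are both positive, the two sums carry the same
  products of the last two factors, and their leading coefficients add up by Pascal's rule.\<close>

lemma num_lists_with_rec:
  assumes "d + e > 0"
  shows "num_lists_with d e k r =
    (if e = 0 then 0 else \<Sum>j<r. num_lists_with d (e - 1) (k + (r - 1 - j)) j)
  + (if d = 0 then 0 else \<Sum>j<k. num_lists_with (d - 1) e j r)"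
proof (cases d)
  case 0
  then obtain e' where e': "e = Suc e'" using assms by (cases e) auto
  \<comment> \<open>Without descents the coefficient of the subtracted product is \<open>e\<close>,
    not 0, so the product has to vanish through its other factors: either \<open>r \<le> e\<close>,
    or \<open>k + r - e\<close> is positive and has no composition into 0 parts.\<close>
  have "compositions r (Suc e) * compositions (k + r - e) 0 = 0"
    by (cases "e < r"; cases "k + r - e") (auto simp: compositions_eq_0)
  then have "num_lists_with 0 (Suc e') k r = (\<Sum>j<r. num_lists_with 0 e' (k + (r - 1 - j)) j)"
    unfolding e' num_lists_with_ascend num_lists_with_def[of 0 "Suc e'"]
    by (auto simp del: compositions.simps)
  then show ?thesis using 0 e' by simp
next
  case (Suc d')
  show ?thesis
  proof (cases e)
    case 0
    then show ?thesis using Suc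
      by (simp add: num_lists_with_descend num_lists_with_def[of "Suc d'"] del: compositions.simps)
  next
    case (Suc e')
    have "num_lists_with (Suc d') (Suc e') k r =
        (\<Sum>j<r. num_lists_with (Suc d') e' (k + (r - 1 - j)) j) + (\<Sum>j<k. num_lists_with d' (Suc e') j r)"
      unfolding num_lists_with_ascend num_lists_with_descend num_lists_with_def[of "Suc d'" "Suc e'"]
      by (simp add: algebra_simps del: compositions.simps)
    then show ?thesis using Suc \<open>d = Suc d'\<close> by simp
  qed
qed

lemma card_lists_with: "finite (lists_with d e k r) \<and> int (card (lists_with d e k r)) = num_lists_with d e k r"
proof (induction "d + e" arbitrary: d e k r)
  case 0
  then show ?case by (cases r) (auto simp: lists_with_0_0 num_lists_with_def)
next
  case (Suc m)
  have asc: "finite (ascend_part d e k r)"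
    "int (card (ascend_part d e k r)) = (if e = 0 then 0 else \<Sum>j<r. num_lists_with d (e - 1) (k + (r - 1 - j)) j)"
  proof -
    have "finite (lists_with d (e - 1) k' r') \<and> int (card (lists_with d (e - 1) k' r')) = num_lists_with d (e - 1) k' r'"
      if "e \<noteq> 0" for k' r' using that Suc.hyps by (intro Suc.hyps(1)) auto
    then show "finite (ascend_part d e k r)"
      "int (card (ascend_part d e k r)) = (if e = 0 then 0 else \<Sum>j<r. num_lists_with d (e - 1) (k + (r - 1 - j)) j)"
      by (auto simp: ascend_part_def card_Union_lists_with inj_on_def)
  qed
  have desc: "finite (descend_part d e k r)"
    "int (card (descend_part d e k r)) = (if d = 0 then 0 else \<Sum>j<k. num_lists_with (d - 1) e j r)"
  proof -
    have "finite (lists_with (d - 1) e k' r') \<and> int (card (lists_with (d - 1) e k' r')) = num_lists_with (d - 1) e k' r'"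
      if "d \<noteq> 0" for k' r' using that Suc.hyps by (intro Suc.hyps(1)) auto
    then show "finite (descend_part d e k r)"
      "int (card (descend_part d e k r)) = (if d = 0 then 0 else \<Sum>j<k. num_lists_with (d - 1) e j r)"
      by (auto simp: descend_part_def card_Union_lists_with inj_on_def)
  qed
  \<comment> \<open>Tails in the first set start with an entry at least \<open>k\<close>, those in
    the second with a smaller one.\<close>
  have "ascend_part d e k r \<inter> descend_part d e k r = {}"
    by (auto simp: ascend_part_def descend_part_def lists_with_def)
  moreover have "d + e > 0" using Suc.hyps(2) by linarith
  ultimately show ?case using asc desc
    by (simp add: lists_with_rec card_image card_Un_disjoint num_lists_with_rec)
qed

section \<open>Summation over the first entry and Narayana numbers\<close>

text \<open>The parameter \<open>n\<close> is modelled on the vertical semiperimeter. Entries may be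
  0 here, since the heights arise by adding 2.\<close>

definition lists_of_size :: "nat \<Rightarrow> nat \<Rightarrow> nat \<Rightarrow> nat list set" where
  "lists_of_size m d n = {xs. length xs = m \<and> descents xs = d \<and> hd xs + excess xs = n}"

lemma binomial_step_real: "real (n choose Suc k) * real (Suc k) = real (n choose k) * (real n - real k)"
proof (cases "k \<le> n")
  case True
  then show ?thesis using binomial_step[of n k] by (metis of_nat_diff of_nat_mult)
qed (simp add: binomial_eq_0)

text \<open>The 2 by 2 determinant form of the Narayana numbers, which matches the difference of
  products in \<open>num_lists_with\<close>. All binomials are expressed through \<open>c\<close> by
  ratios of neighbours.\<close>

lemma narayana_eq_diff:
  "narayana (d + e + 1) (d + 1) =
     real ((d + e) choose d) ^ 2
   - real ((d + e) choose Suc d) * (if d = 0 then 0 else real ((d + e) choose (d - 1)))"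
proof -
  define c where "c = real ((d + e) choose d)"
  have 1: "real ((d + e) choose Suc d) = c * real e / (real d + 1)"
    using binomial_step_real[of "d + e" d] by (simp add: c_def field_simps)
  have 2: "(if d = 0 then 0 else real ((d + e) choose (d - 1))) = c * real d / (real e + 1)"
    using binomial_step_real[of "d + e" "d - 1"] by (cases d) (simp_all add: c_def field_simps)
  have 3: "real ((d + e + 1) choose (d + 1)) = c + c * real e / (real d + 1)"
    using 1 by (simp add: c_def)
  have 4: "real ((d + e + 1) choose d) = c + c * real d / (real e + 1)"
    using 2 by (cases d) (simp_all add: c_def)
  have "narayana (d + e + 1) (d + 1) =
     1 / (real d + real e + 1) * (c + c * real e / (real d + 1)) * (c + c * real d / (real e + 1))"
    unfolding narayana_def using 3 4 by (simp add: add_ac)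
  also have "\<dots> = c^2 - (c * real e / (real d + 1)) * (c * real d / (real e + 1))"
  proof -
    have "c + c * real e / (real d + 1) = c * (real d + real e + 1) / (real d + 1)"
      "c + c * real d / (real e + 1) = c * (real d + real e + 1) / (real e + 1)"
      by (simp_all add: field_simps)
    moreover have "real d + real e + 1 \<noteq> 0" "real d + 1 \<noteq> 0" "real e + 1 \<noteq> 0" by linarith+
    \<comment> \<open>The core is \<open>p * q - (q - 1) * (p - 1) = p + q - 1\<close>, used with
      \<open>p = d + 1\<close> and \<open>q = e + 1\<close>.\<close>
    moreover have "1 / s * (c * s / p) * (c * s / q) = c^2 - (c * (q - 1) / p) * (c * (p - 1) / q)"
      if "s \<noteq> 0" "p \<noteq> 0" "q \<noteq> 0" "s = p + q - 1" for s p q :: real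
    proof -
      have "1 / s * (c * s / p) * (c * s / q) = c^2 * s / (p * q)"
        using that(1-3) by (simp add: field_simps power2_eq_square)
      also have "\<dots> = c^2 * (p * q - (q - 1) * (p - 1)) / (p * q)"
        unfolding that(4) by (simp add: algebra_simps)
      also have "\<dots> = c^2 - (c * (q - 1) / p) * (c * (p - 1) / q)"
        using that(2,3) by (simp add: field_simps power2_eq_square)
      finally show ?thesis .
    qed
    from this[of "real d + real e + 1" "real d + 1" "real e + 1"] calculation
    show ?thesis by simp
  qed
  finally show ?thesis unfolding 1 2 by (simp only: c_def)
qed

lemma lists_of_size_eq: "lists_of_size (d + e + 1) d n = (\<Union>r<Suc n. lists_with d e (n - r) r)"
  by (auto simp: lists_of_size_def lists_with_def)

text \<open>With first entry \<open>n - r\<close> the quantity \<open>k + r - e\<close> is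
  constantly \<open>n - e\<close>, so only the factors in \<open>r\<close> are summed; the sum up to
  \<open>n\<close> gives \<open>compositions (Suc n) (Suc e)\<close>, that is
  \<open>n choose e\<close>.\<close>

lemma sum_num_lists_with:
  "(\<Sum>r<Suc n. num_lists_with d e (n - r) r) =
     int ((d + e) choose d) * int (n choose e) * int ((n - e) choose d)
   - int ((d + e) choose Suc d) * int (n choose Suc e) * int (compositions (n - e) d)"
proof -
  have "(\<Sum>r<Suc n. num_lists_with d e (n - r) r) = (\<Sum>r<Suc n.
      int ((d + e) choose d) * int ((n - e) choose d) * int (compositions r e)
    - int ((d + e) choose Suc d) * int (compositions (n - e) d) * int (compositions r (Suc e)))"
    by (intro sum.cong) (simp_all add: num_lists_with_def mult_ac)
  also have "\<dots> = int ((d + e) choose d) * int ((n - e) choose d) * int (\<Sum>r<Suc n. compositions r e)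
    - int ((d + e) choose Suc d) * int (compositions (n - e) d) * int (\<Sum>r<Suc n. compositions r (Suc e))"
    by (simp only: sum_subtractf sum_distrib_left of_nat_sum)
  also have "\<dots> = int ((d + e) choose d) * int (n choose e) * int ((n - e) choose d)
   - int ((d + e) choose Suc d) * int (n choose Suc e) * int (compositions (n - e) d)"
    by (simp only: sum_compositions compositions.simps(4) mult_ac)
  finally show ?thesis .
qed

lemma choose_mult_sub: "(n choose a) * ((n - a) choose b) = (n choose (a + b)) * ((a + b) choose a)"
proof (cases "a + b \<le> n")
  case True
  then show ?thesis using choose_mult[of a "a + b" n] by simp
next
  case False
  then show ?thesis by (cases "a \<le> n") (simp_all add: binomial_eq_0)
qed

text \<open>Regrouping the binomials extracts \<open>n choose (d + e)\<close> from both products and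
  leaves the determinant form of the Narayana number. For \<open>d \<ge> m\<close> both sides are
  0.\<close>

lemma card_lists_of_size:
  assumes "m > 0"
  shows "finite (lists_of_size m d n) \<and>
    real (card (lists_of_size m d n)) = narayana m (d + 1) * real (n choose (m - 1))"
proof (cases "d < m")
  case False
  have "lists_of_size m d n = {}"
    using False descents_less assms by (fastforce simp: lists_of_size_def)
  then show ?thesis using False by (simp add: narayana_def)
next
  case True
  then obtain e where m: "m = d + e + 1" using less_iff_Suc_add by auto
  have "int (card (lists_of_size m d n)) = (\<Sum>r<Suc n. num_lists_with d e (n - r) r)"
    unfolding m lists_of_size_eq
    using card_lists_with by (subst card_Union_lists_with) (auto simp: inj_on_def)
  also have "\<dots> = int (n choose (d + e)) * (int ((d + e) choose d) ^ 2
    - int ((d + e) choose Suc d) * (if d = 0 then 0 else int ((d + e) choose (d - 1))))"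
  proof -
    have "(n choose e) * ((n - e) choose d) = (n choose (d + e)) * ((d + e) choose d)"
      using choose_mult_sub[of n e d] binomial_symmetric[of e "d + e"] by (simp add: add.commute)
    moreover have "(n choose Suc e) * compositions (n - e) d =
      (n choose (d + e)) * (if d = 0 then 0 else (d + e) choose (d - 1))"
    proof (cases d)
      case 0
      then show ?thesis by (cases "n - e") auto
    next
      case (Suc d')
      \<comment> \<open>The exceptional case \<open>n \<le> e\<close> is harmless because then
        \<open>n choose Suc e\<close> is 0.\<close>
      have "compositions (n - e) (Suc d') = (n - Suc e) choose d' \<or> n \<le> e"
        by (cases "n - e") (auto simp: Suc_diff_Suc diff_Suc)
      then have "(n choose Suc e) * compositions (n - e) d = (n choose Suc e) * ((n - Suc e) choose d')"
        using Suc by auto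
      also have "\<dots> = (n choose (d + e)) * ((d + e) choose (d - 1))"
        using choose_mult_sub[of n "Suc e" d'] binomial_symmetric[of "Suc e" "d + e"] Suc
        by (simp add: add.commute)
      finally show ?thesis using Suc by simp
    qed
    ultimately have "int (n choose e) * int ((n - e) choose d) = int (n choose (d + e)) * int ((d + e) choose d)"
       "int (n choose Suc e) * int (compositions (n - e) d) =
      int (n choose (d + e)) * (if d = 0 then 0 else int ((d + e) choose (d - 1)))"
      by (metis of_nat_mult, simp flip: of_nat_mult)
    then show ?thesis
      unfolding sum_num_lists_with mult.assoc by (simp add: power2_eq_square algebra_simps)
  qed
  finally have "real_of_int (int (card (lists_of_size m d n))) = real_of_int \<dots>" by simp
  then have "real (card (lists_of_size m d n)) = real (n choose (d + e)) * narayana (d + e + 1) (d + 1)"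
    unfolding narayana_eq_diff by (simp split: if_splits)
  moreover have "finite (lists_of_size m d n)"
    unfolding m lists_of_size_eq using card_lists_with by blast
  ultimately show ?thesis by (simp add: m mult.commute)
qed

section \<open>Fibonacci polyominoes and height lists\<close>

text \<open>The representative of the translation class whose first column has its bottom cell at
  the origin.\<close>

definition staircase :: "nat list \<Rightarrow> cell set" where
  "staircase hs = (SIGMA x:{0..<int (length hs)}. {x..<x + int (hs ! nat x)})"

text \<open>Column \<open>i + 1\<close> starts one row higher than column \<open>i\<close>, so
  height at least 2 is what lets the two share an edge; the last column only has to be
  nonempty.\<close>

definition admissible :: "nat list \<Rightarrow> bool" where
  "admissible hs \<longleftrightarrow> hs \<noteq> [] \<and> (\<forall>h\<in>set (butlast hs). 2 \<le> h) \<and> 1 \<le> last hs"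

lemma admissible_iff_nth:
  "admissible hs \<longleftrightarrow> hs \<noteq> [] \<and> (\<forall>i<length hs. 1 \<le> hs ! i) \<and> (\<forall>i. Suc i < length hs \<longrightarrow> 2 \<le> hs ! i)"
proof -
  have bl: "(\<forall>h\<in>set (butlast hs). 2 \<le> h) \<longleftrightarrow> (\<forall>i. Suc i < length hs \<longrightarrow> 2 \<le> hs ! i)"
    by (auto simp: in_set_conv_nth nth_butlast all_set_conv_all_nth less_diff_conv)
  show ?thesis
  proof (cases hs rule: rev_cases)
    case (snoc ys h)
    have "(\<forall>i<length hs. 1 \<le> hs ! i)" if "1 \<le> h" "\<forall>i. Suc i < length hs \<longrightarrow> 2 \<le> hs ! i"
    proof (intro allI impI)
      fix i assume "i < length hs"
      then consider "i = length ys" | "Suc i < length hs" using snoc by force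
      then show "1 \<le> hs ! i"
        using that snoc by cases (force simp: nth_append)+
    qed
    moreover have "1 \<le> h" if "\<forall>i<length hs. 1 \<le> hs ! i"
      using that[rule_format, of "length ys"] snoc by simp
    ultimately show ?thesis using bl snoc by (auto simp: admissible_def)
  qed (simp add: admissible_def)
qed

lemma mem_staircase:
  "(x, y) \<in> staircase hs \<longleftrightarrow> 0 \<le> x \<and> x < int (length hs) \<and> x \<le> y \<and> y < x + int (hs ! nat x)"
  by (auto simp: staircase_def)

lemma finite_staircase: "finite (staircase hs)"
  by (simp add: staircase_def)

lemma column_staircase:
  "column (staircase hs) x =
     (if 0 \<le> x \<and> x < int (length hs) then {x..<x + int (hs ! nat x)} else {})"
  by (auto simp: column_def mem_staircase)

lemma fst_staircase:
  assumes "admissible hs" shows "fst ` staircase hs = {0..<int (length hs)}"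
proof -
  have "x \<in> fst ` staircase hs" if "0 \<le> x" "x < int (length hs)" for x
  proof -
    have "nat x < length hs" using that by simp
    then have "1 \<le> hs ! nat x" using assms by (auto simp: admissible_iff_nth)
    then have "(x, x) \<in> staircase hs" using that by (simp add: mem_staircase)
    then show ?thesis by force
  qed
  then show ?thesis by (auto simp: staircase_def)
qed

lemma descents_eq_card: "descents xs = card {i. Suc i < length xs \<and> xs ! Suc i < xs ! i}"
proof (induction xs rule: descents.induct)
  case (1 a b xs)
  let ?D = "\<lambda>xs :: nat list. {i. Suc i < length xs \<and> xs ! Suc i < xs ! i}"
  have "?D (a # b # xs) = (if b < a then {0} else {}) \<union> Suc ` ?D (b # xs)"
  proof (intro set_eqI)
    fix i show "i \<in> ?D (a # b # xs) \<longleftrightarrow> i \<in> (if b < a then {0} else {}) \<union> Suc ` ?D (b # xs)"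
      by (cases i) auto
  qed
  moreover have "finite (?D (b # xs))"
    by (rule finite_subset[of _ "{..<length (b # xs)}"]) auto
  ultimately show ?case using 1 by (simp add: card_image)
qed auto

lemma des_staircase:
  assumes "admissible hs" shows "des_cells (staircase hs) = descents hs"
proof -
  have ne: "hs \<noteq> []" using assms by (simp add: admissible_def)
  have num: "num_columns (staircase hs) = length hs"
    by (simp add: num_columns_def fst_staircase assms)
  have "Min (fst ` staircase hs) = 0"
    unfolding fst_staircase[OF assms] using ne by (intro Min_eqI) auto
  then have height: "column_height (staircase hs) (Suc i) = hs ! i" if "i < length hs" for i
    using that by (simp add: column_height_def column_staircase)
  \<comment> \<open>Columns are numbered from 1 and list positions from 0, hence the shift by
    \<open>Suc\<close>.\<close>
  have "{i. 1 \<le> i \<and> i < num_columns (staircase hs) \<and>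
      column_height (staircase hs) i > column_height (staircase hs) (i + 1)}
    = Suc ` {i. Suc i < length hs \<and> hs ! Suc i < hs ! i}" (is "?L = Suc ` ?R")
  proof (intro set_eqI)
    fix i show "i \<in> ?L \<longleftrightarrow> i \<in> Suc ` ?R"
      by (cases i) (auto simp: num height)
  qed
  then show ?thesis by (simp add: des_cells_def descents_eq_card card_image)
qed

section \<open>Boundary edges and semiperimeters\<close>

text \<open>A unit edge borders exactly two cells, so being on the boundary becomes an exclusive or
  of two memberships.\<close>

lemma ex1_mem_pair:
  "a \<noteq> b \<Longrightarrow> (\<exists>!c. c \<in> S \<and> (c = a \<or> c = b)) \<longleftrightarrow> (a \<in> S) \<noteq> (b \<in> S)"
  by auto

lemma vertical_boundary_iff:
  "(\<exists>!c. c \<in> S \<and> (x, y) \<in> vertical_edges c) \<longleftrightarrow> ((x, y) \<in> S) \<noteq> ((x - 1, y) \<in> S)"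
proof -
  have "(x, y) \<in> vertical_edges c \<longleftrightarrow> c = (x, y) \<or> c = (x - 1, y)" for c
    by (cases c) (auto simp: vertical_edges_def)
  then show ?thesis by (simp add: ex1_mem_pair)
qed

lemma horizontal_boundary_iff:
  "(\<exists>!c. c \<in> S \<and> (x, y) \<in> horizontal_edges c) \<longleftrightarrow> ((x, y) \<in> S) \<noteq> ((x, y - 1) \<in> S)"
proof -
  have "(x, y) \<in> horizontal_edges c \<longleftrightarrow> c = (x, y) \<or> c = (x, y - 1)" for c
    by (cases c) (auto simp: horizontal_edges_def)
  then show ?thesis by (simp add: ex1_mem_pair)
qed

lemma card_Sigma_int:
  assumes "\<And>i. i < m \<Longrightarrow> finite (D (int i))"
  shows "card (SIGMA x:{0..<int m}. D x) = (\<Sum>i<m. card (D (int i)))"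
proof -
  have eq: "{0..<int m} = int ` {..<m}"
    by (simp add: image_int_atLeastLessThan lessThan_atLeast0)
  show ?thesis unfolding eq using assms
    by (subst card_SigmaI) (auto simp: sum.reindex inj_on_def)
qed

lemma hsemi_staircase:
  assumes "admissible hs" shows "hsemi_cells (staircase hs) = real (length hs)"
proof -
  have pos: "1 \<le> hs ! i" if "i < length hs" for i
    using assms that by (auto simp: admissible_iff_nth)
  have "{e. \<exists>!c. c \<in> staircase hs \<and> e \<in> horizontal_edges c}
      = (SIGMA x:{0..<int (length hs)}. {x, x + int (hs ! nat x)})" (is "?L = ?R")
  proof (intro set_eqI)
    fix e :: cell obtain x y where e: "e = (x, y)" by (cases e)
    have "1 \<le> hs ! nat x" if "0 \<le> x" "x < int (length hs)" using that by (intro pos) simp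
    then show "e \<in> ?L \<longleftrightarrow> e \<in> ?R"
      unfolding e mem_Collect_eq horizontal_boundary_iff mem_staircase by auto
  qed
  then have "card {e. \<exists>!c. c \<in> staircase hs \<and> e \<in> horizontal_edges c}
      = (\<Sum>i<length hs. card {int i, int i + int (hs ! i)})"
    by (simp only: card_Sigma_int nat_int finite.intros)
  also have "\<dots> = (\<Sum>i<length hs. 2)"
    using pos by (intro sum.cong) (force simp: card_insert_if)+
  finally show ?thesis by (simp add: hsemi_cells_def)
qed

text \<open>For neighbours \<open>a\<close>, \<open>b\<close> the summand equals
  \<open>a - b\<close> plus twice their contribution to the excess, in both cases
  \<open>b < a\<close> and \<open>a \<le> b\<close>. The differences telescope to
  \<open>hd xs - last xs\<close>.\<close>

lemma hd_last_excess:
  "xs \<noteq> [] \<Longrightarrow> hd xs + (\<Sum>i<length xs - 1. 1 + nat \<bar>int (xs ! i) - 1 - int (xs ! Suc i)\<bar>) + last xs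
     = 2 * (hd xs + excess xs)"
proof (induction xs rule: excess.induct)
  case (1 a b xs)
  then show ?case
    by (simp add: sum.lessThan_Suc_shift nat_abs_int_diff del: sum.lessThan_Suc) linarith
qed auto

text \<open>Row \<open>i\<close> meets only the left column. From row \<open>i + 1\<close> on both
  columns are present, and they differ exactly between their tops.\<close>

lemma card_column_difference:
  fixes i :: int
  assumes "2 \<le> a"
  shows "card {y. (i \<le> y \<and> y < i + int a) \<noteq> (i + 1 \<le> y \<and> y < i + 1 + int b)}
     = 1 + nat \<bar>int a - 1 - int b\<bar>"
proof -
  have "{y. (i \<le> y \<and> y < i + int a) \<noteq> (i + 1 \<le> y \<and> y < i + 1 + int b)}
      = insert i {min (i + int a) (i + 1 + int b)..<max (i + int a) (i + 1 + int b)}"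
    using assms by auto
  moreover have "i \<notin> {min (i + int a) (i + 1 + int b)..<max (i + int a) (i + 1 + int b)}"
    using assms by auto
  ultimately show ?thesis by simp
qed

lemma vsemi_staircase:
  assumes "admissible hs" shows "vsemi_cells (staircase hs) = real (hd hs + excess hs)"
proof -
  have ne: "hs \<noteq> []" and two: "\<And>i. Suc i < length hs \<Longrightarrow> 2 \<le> hs ! i"
    using assms by (auto simp: admissible_iff_nth)
  obtain k where k: "length hs = Suc k" using ne by (cases hs) auto
  \<comment> \<open>The rows of the vertical boundary edges at abscissa \<open>x\<close>. The
    \<open>k + 1\<close> columns have \<open>k + 2\<close> such abscissas, and the outermost two see
    a single column.\<close>
  define D where "D x = {y. ((x, y) \<in> staircase hs) \<noteq> ((x - 1, y) \<in> staircase hs)}" for x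
  have D0: "D 0 = {0..<int (hs ! 0)}"
    using ne by (auto simp: D_def mem_staircase)
  have Dk: "D (int (Suc k)) = {int k..<int k + int (hs ! k)}"
    by (auto simp: D_def mem_staircase k)
  have D: "D (int (Suc i)) = {y. (int i \<le> y \<and> y < int i + int (hs ! i)) \<noteq>
      (int i + 1 \<le> y \<and> y < int i + 1 + int (hs ! Suc i))}" if "i < k" for i
    using that by (auto simp: D_def mem_staircase k nat_add_distrib)
  have cD: "card (D (int (Suc i))) = 1 + nat \<bar>int (hs ! i) - 1 - int (hs ! Suc i)\<bar>" if "i < k" for i
    unfolding D[OF that] using that by (intro card_column_difference two) (simp add: k)
  have fin: "finite (D x)" for x
  proof -
    have "D x \<subseteq> column (staircase hs) x \<union> column (staircase hs) (x - 1)"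
      by (auto simp: D_def column_def)
    then show ?thesis
      by (rule finite_subset) (simp add: finite_column finite_staircase)
  qed
  have "{e. \<exists>!c. c \<in> staircase hs \<and> e \<in> vertical_edges c} = (SIGMA x:{0..<int (Suc (Suc k))}. D x)"
    (is "?L = ?R")
  proof (intro set_eqI)
    fix e :: cell obtain x y where e: "e = (x, y)" by (cases e)
    show "e \<in> ?L \<longleftrightarrow> e \<in> ?R"
      unfolding e mem_Collect_eq vertical_boundary_iff by (auto simp: D_def mem_staircase k)
  qed
  then have "card {e. \<exists>!c. c \<in> staircase hs \<and> e \<in> vertical_edges c} = (\<Sum>i<Suc (Suc k). card (D (int i)))"
    using fin by (simp only: card_Sigma_int)
  also have "\<dots> = card (D 0) + (\<Sum>i<k. card (D (int (Suc i)))) + card (D (int (Suc k)))"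
    by (subst sum.lessThan_Suc_shift) simp
  also have "\<dots> = hd hs + (\<Sum>i<length hs - 1. 1 + nat \<bar>int (hs ! i) - 1 - int (hs ! Suc i)\<bar>) + last hs"
    using ne by (simp add: D0 Dk cD k hd_conv_nth last_conv_nth del: of_nat_Suc)
  also have "\<dots> = 2 * (hd hs + excess hs)" by (rule hd_last_excess[OF ne])
  finally show ?thesis by (simp add: vsemi_cells_def)
qed

section \<open>Staircases represent Fibonacci polyominoes\<close>

lemma column_convex_staircase: "column_convex_cells (staircase hs)"
  unfolding column_convex_cells_def
proof
  fix x :: int
  have "{x..<x + int (hs ! nat x)} = {x..x + int (hs ! nat x) - 1}" "{} = {1..0::int}" by auto
  then show "\<exists>a b. column (staircase hs) x = {a..b}"
    unfolding column_staircase by meson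
qed

lemma rising_bottoms_staircase: "rising_bottoms_cells (staircase hs)"
proof -
  have "Min {x..<x + int h} = x" if "{x..<x + int h} \<noteq> {}" for x h
    using that by (intro Min_eqI) auto
  then show ?thesis
    by (auto simp: rising_bottoms_cells_def column_staircase split: if_splits)
qed

text \<open>Every cell is joined to the origin: go down to the bottom of its column, step left to
  the second cell of the preceding column, and repeat.\<close>

lemma edge_connected_staircase:
  assumes "admissible hs" shows "edge_connected (staircase hs)"
proof -
  define R where "R = {(a, b). a \<in> staircase hs \<and> b \<in> staircase hs \<and> adjacent a b}"
  have sym: "sym (R\<^sup>*)"
    by (rule sym_rtrancl) (auto simp: R_def sym_def adjacent_def abs_minus_commute)
  have down: "((x, x + int k), (x, x)) \<in> R\<^sup>*" if "(x, x + int k) \<in> staircase hs" for x k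
    using that
  proof (induction k)
    case (Suc k)
    then have "(x, x + int k) \<in> staircase hs" by (auto simp: mem_staircase)
    moreover from this Suc.prems have "((x, x + int (Suc k)), (x, x + int k)) \<in> R"
      by (auto simp: R_def adjacent_def)
    ultimately show ?case using Suc.IH by (meson converse_rtrancl_into_rtrancl)
  qed simp
  have bottom: "((int i, int i), (0, 0)) \<in> R\<^sup>*" if "i < length hs" for i
    using that
  proof (induction i)
    case (Suc i)
    have "2 \<le> hs ! i" "1 \<le> hs ! Suc i" using assms Suc.prems by (auto simp: admissible_iff_nth)
    then have *: "(int (Suc i), int (Suc i)) \<in> staircase hs" "(int i, int i + int 1) \<in> staircase hs"
      using Suc.prems by (auto simp: mem_staircase nat_add_distrib)
    then have "((int (Suc i), int (Suc i)), (int i, int i + int 1)) \<in> R"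
      by (auto simp: R_def adjacent_def)
    moreover have "((int i, int i + int 1), (int i, int i)) \<in> R\<^sup>*" by (rule down) (rule *)
    moreover have "((int i, int i), (0, 0)) \<in> R\<^sup>*" using Suc by simp
    ultimately show ?case by (meson converse_rtrancl_into_rtrancl rtrancl_trans)
  qed simp
  have root: "(c, (0, 0)) \<in> R\<^sup>*" if "c \<in> staircase hs" for c
  proof -
    obtain x y where c: "c = (x, y)" by (cases c)
    then have xy: "0 \<le> x" "x < int (length hs)" "x \<le> y" using that by (auto simp: mem_staircase)
    then have "(c, (x, x)) \<in> R\<^sup>*" using down[of x "nat (y - x)"] c that by simp
    moreover have "((x, x), (0, 0)) \<in> R\<^sup>*" using bottom[of "nat x"] xy by simp
    ultimately show ?thesis by (rule rtrancl_trans)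
  qed
  show ?thesis
    unfolding edge_connected_def R_def[symmetric]
    using root sym by (meson rtrancl_trans symD)
qed

lemma polyomino_staircase:
  assumes "admissible hs" shows "polyomino_cells (staircase hs)"
proof -
  have "fst ` staircase hs \<noteq> {}"
    using assms by (simp add: fst_staircase) (simp add: admissible_def)
  then show ?thesis
    by (auto simp: polyomino_cells_def finite_staircase edge_connected_staircase assms)
qed

section \<open>Every Fibonacci polyomino is a staircase\<close>

text \<open>A path from abscissa at most \<open>x\<close> to one beyond \<open>x\<close> has a first
  step beyond \<open>x\<close>; that step is horizontal, so its two cells lie in the same
  row.\<close>

lemma edge_connected_crossing:
  assumes "edge_connected S" "c \<in> S" "c' \<in> S" "fst c \<le> x" "x < fst c'"
  shows "\<exists>y. (x, y) \<in> S \<and> (x + 1, y) \<in> S"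
proof -
  have "(c, c') \<in> {(a, b). a \<in> S \<and> b \<in> S \<and> adjacent a b}\<^sup>*"
    using assms by (auto simp: edge_connected_def)
  then show ?thesis using assms(5)
  proof (induction rule: rtrancl_induct)
    case base then show ?case using assms(4) by simp
  next
    case (step a b)
    show ?case
    proof (cases "x < fst a")
      case False
      with step have "a \<in> S" "b \<in> S" "fst a = x" "fst b = x + 1" "snd a = snd b"
        by (auto simp: adjacent_def)
      then show ?thesis by (metis prod.collapse)
    qed (use step in auto)
  qed
qed

lemma exists_staircase:
  assumes poly: "polyomino_cells S" and conv: "column_convex_cells S" and rise: "rising_bottoms_cells S"
  shows "\<exists>hs v. admissible hs \<and> (+) v ` staircase hs = S"
proof -
  have fin: "finite S" and ne: "S \<noteq> {}" and conn: "edge_connected S"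
    using poly by (auto simp: polyomino_cells_def)
  define a b where "a = Min (fst ` S)" and "b = Max (fst ` S)"
  have range: "a \<le> x" "x \<le> b" if "(x, y) \<in> S" for x y
    using that fin by (force simp: a_def b_def intro: Min_le Max_ge)+
  have "a \<in> fst ` S" "b \<in> fst ` S" unfolding a_def b_def using fin ne by (auto intro!: Min_in Max_in)
  then obtain ca cb where ab: "ca \<in> S" "fst ca = a" "cb \<in> S" "fst cb = b" by auto
  have crossing: "\<exists>y. (x, y) \<in> S \<and> (x + 1, y) \<in> S" if "a \<le> x" "x < b" for x
    using edge_connected_crossing[OF conn ab(1,3)] ab that by simp
  have col_ne: "column S x \<noteq> {}" if "a \<le> x" "x \<le> b" for x
  proof (cases "x = b")
    case True then show ?thesis using ab by (auto simp: column_def intro: exI[of _ "snd cb"])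
  next
    case False then show ?thesis using crossing[of x] that by (auto simp: column_def)
  qed
  define m where "m = nat (b - a + 1)"
  have m: "int m = b - a + 1" using range[of a "snd ca"] ab by (auto simp: m_def)
  define hs where "hs = map (\<lambda>i. card (column S (a + int i))) [0..<m]"
  \<comment> \<open>The lowest cell of the leftmost column is \<open>(a, z)\<close>, which is also
    the translation vector.\<close>
  define z where "z = Min (column S a)"
  have bot: "Min (column S (a + int i)) = z + int i" if "i < m" for i
    using that
  proof (induction i)
    case (Suc i)
    have "column S (a + int i) \<noteq> {}" "column S (a + int i + 1) \<noteq> {}"
      using Suc.prems m by (intro col_ne; linarith)+
    then have "Min (column S (a + int i + 1)) = Min (column S (a + int i)) + 1"
      using rise by (auto simp: rising_bottoms_cells_def)
    then show ?case using Suc by (simp add: algebra_simps)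
  qed (simp add: z_def)
  have col: "column S (a + int i) = {z + int i..<z + int i + int (hs ! i)}" if "i < m" for i
  proof -
    have "column S (a + int i) \<noteq> {}" using that m by (intro col_ne) auto
    moreover obtain p q where pq: "column S (a + int i) = {p..q}"
      using conv unfolding column_convex_cells_def by blast
    ultimately have "p \<le> q" by auto
    then have "Min {p..q} = p" by (intro Min_eqI) auto
    then have "p = z + int i" using bot[OF that] pq by simp
    moreover have "int (hs ! i) = q - p + 1" using that pq \<open>p \<le> q\<close> by (simp add: hs_def)
    ultimately show ?thesis using pq by auto
  qed
  have "admissible hs"
    unfolding admissible_iff_nth
  proof (intro conjI allI impI)
    show "hs \<noteq> []" using m range[of a "snd ca"] ab by (auto simp: hs_def)
  next
    fix i assume "i < length hs"
    then have i: "i < m" by (simp add: hs_def)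
    then have "column S (a + int i) \<noteq> {}" using m by (intro col_ne) auto
    then show "1 \<le> hs ! i" using col[OF i] by (cases "hs ! i") auto
  next
    fix i assume "Suc i < length hs"
    then have i: "Suc i < m" by (simp add: hs_def)
    then obtain y where "(a + int i, y) \<in> S" "(a + int (Suc i), y) \<in> S"
      using crossing[of "a + int i"] m by (auto simp: algebra_simps)
    \<comment> \<open>The common row \<open>y\<close> is at least the bottom of column
      \<open>i + 1\<close>, hence strictly above the bottom of column \<open>i\<close>.\<close>
    then have "y \<in> column S (a + int i)" "y \<in> column S (a + int (Suc i))" by (auto simp: column_def)
    then show "2 \<le> hs ! i" using col[of i] col[of "Suc i"] i by auto
  qed
  moreover have "(+) (a, z) ` staircase hs = S"
  proof (intro set_eqI)
    fix c :: cell obtain x y where c: "c = (x, y)" by (cases c)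
    show "c \<in> (+) (a, z) ` staircase hs \<longleftrightarrow> c \<in> S"
    proof (cases "a \<le> x \<and> x \<le> b")
      case True
      define i where "i = nat (x - a)"
      have i: "x = a + int i" "i < m" using True m by (auto simp: i_def)
      have "c \<in> S \<longleftrightarrow> y \<in> column S (a + int i)" using c i by (simp add: column_def)
      then show ?thesis unfolding c mem_translate mem_staircase col[OF i(2)]
        using i by (auto simp: hs_def)
    next
      case False
      then show ?thesis unfolding c mem_translate mem_staircase
        using range[of x y] m by (auto simp: hs_def)
    qed
  qed
  ultimately show ?thesis by blast
qed

text \<open>Comparing the projections forces \<open>fst v = 0\<close>. The heights are then column
  cardinalities, which a vertical shift preserves.\<close>

lemma staircase_translate_inj:
  assumes "admissible hs" "admissible hs'" "staircase hs' = (+) v ` staircase hs"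
  shows "hs = hs'"
proof -
  have "fst ` staircase hs' = (+) (fst v) ` fst ` staircase hs"
    unfolding assms(3) by (simp add: image_image)
  then have "{0..<int (length hs')} = {fst v..<fst v + int (length hs)}"
    unfolding fst_staircase[OF assms(1)] fst_staircase[OF assms(2)] by (simp add: add.commute)
  moreover have "length hs > 0" "length hs' > 0" using assms by (auto simp: admissible_def)
  ultimately have v: "fst v = 0" and len: "length hs = length hs'"
    by (auto simp: atLeastLessThan_eq_iff)
  show ?thesis
  proof (rule nth_equalityI[OF len])
    fix i assume "i < length hs"
    then show "hs ! i = hs' ! i"
      using card_column_translate[of v "staircase hs" "int i"] v len
      unfolding assms(3)[symmetric] by (simp add: column_staircase)
  qed
qed

section \<open>Passage to translation classes\<close>

definition staircase_polyomino :: "nat list \<Rightarrow> polyomino" where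
  "staircase_polyomino hs = abs_polyomino (staircase hs)"

text \<open>The quotient is partial, so computing with abstracted representatives requires this
  reflexivity.\<close>

lemma translation_equiv_refl: "polyomino_cells S \<Longrightarrow> translation_equiv S S"
  unfolding translation_equiv_def by (intro conjI exI[of _ 0]) simp_all

lemma inj_on_staircase_polyomino: "inj_on staircase_polyomino (Collect admissible)"
proof (rule inj_onI)
  fix hs hs' assume adm: "hs \<in> Collect admissible" "hs' \<in> Collect admissible"
    and "staircase_polyomino hs = staircase_polyomino hs'"
  then have "translation_equiv (staircase hs) (staircase hs')"
    using Quotient_rel[OF Quotient_polyomino] translation_equiv_refl polyomino_staircase
    by (metis mem_Collect_eq staircase_polyomino_def)
  then show "hs = hs'"
    using adm staircase_translate_inj by (auto simp: translation_equiv_def)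
qed

lemma staircase_polyomino_simps:
  assumes "admissible hs"
  shows "fibonacci_polyomino (staircase_polyomino hs)"
    "hsemiperimeter (staircase_polyomino hs) = real (length hs)"
    "vsemiperimeter (staircase_polyomino hs) = real (hd hs + excess hs)"
    "des (staircase_polyomino hs) = descents hs"
proof -
  have refl: "translation_equiv (staircase hs) (staircase hs)"
    by (intro translation_equiv_refl polyomino_staircase assms)
  show "fibonacci_polyomino (staircase_polyomino hs)"
    "hsemiperimeter (staircase_polyomino hs) = real (length hs)"
    "vsemiperimeter (staircase_polyomino hs) = real (hd hs + excess hs)"
    "des (staircase_polyomino hs) = descents hs"
    using assms refl
    by (simp_all add: staircase_polyomino_def fibonacci_polyomino_def column_convex.abs_eq rising_bottoms.abs_eq
        hsemiperimeter.abs_eq vsemiperimeter.abs_eq des.abs_eq column_convex_staircase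
        rising_bottoms_staircase hsemi_staircase vsemi_staircase des_staircase)
qed

lemma fibonacci_polyomino_imp_staircase:
  assumes "fibonacci_polyomino P"
  shows "\<exists>hs. admissible hs \<and> P = staircase_polyomino hs"
proof -
  define S where "S = rep_polyomino P"
  have P: "P = abs_polyomino S" and S: "translation_equiv S S"
    unfolding S_def using Quotient_abs_rep[OF Quotient_polyomino] Quotient_rep_reflp[OF Quotient_polyomino]
    by auto
  have "polyomino_cells S" "column_convex_cells S" "rising_bottoms_cells S"
    using assms S unfolding P fibonacci_polyomino_def
    by (auto simp: column_convex.abs_eq rising_bottoms.abs_eq translation_equiv_def)
  then obtain hs v where hs: "admissible hs" "(+) v ` staircase hs = S"
    using exists_staircase by blast
  then have "translation_equiv (staircase hs) S"
    using S polyomino_staircase unfolding translation_equiv_def by blast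
  then have "P = staircase_polyomino hs"
    unfolding P staircase_polyomino_def using Quotient_rel_abs[OF Quotient_polyomino] by metis
  then show ?thesis using hs by blast
qed

lemma fibonacci_polyominoes_eq:
  "fibonacci_polyominoes m n =
     staircase_polyomino ` {hs. admissible hs \<and> length hs = m \<and> hd hs + excess hs = n}"
  by (auto simp: fibonacci_polyominoes_def staircase_polyomino_simps simp flip: of_nat_add
      dest!: fibonacci_polyomino_imp_staircase)

section \<open>Enumeration\<close>

definition admissible_lists :: "nat \<Rightarrow> nat \<Rightarrow> nat \<Rightarrow> nat list set" where
  "admissible_lists m d n = {hs \<in> lists_of_size m d n. admissible hs}"

lemma fibonacci_polyominoes_des_eq:
  "{P \<in> fibonacci_polyominoes m n. des P = d} = staircase_polyomino ` admissible_lists m d n"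
  by (auto simp: fibonacci_polyominoes_eq admissible_lists_def lists_of_size_def staircase_polyomino_simps)

lemma descents_map_add: "descents (map ((+) c) xs) = descents xs"
  by (induction xs rule: descents.induct) auto

lemma excess_map_add: "excess (map ((+) c) xs) = excess xs"
  by (induction xs rule: excess.induct) auto

text \<open>For a final height 1 after heights at least 2: the last step is then always a descent,
  and descents add nothing to the excess.\<close>

lemma descents_snoc: "xs \<noteq> [] \<Longrightarrow> h < last xs \<Longrightarrow> descents (xs @ [h]) = Suc (descents xs)"
  by (induction xs rule: descents.induct) auto

lemma excess_snoc: "xs \<noteq> [] \<Longrightarrow> h < last xs \<Longrightarrow> excess (xs @ [h]) = excess xs"
  by (induction xs rule: excess.induct) auto

lemma exists_map_add:
  assumes "\<forall>h\<in>set hs. (c::nat) \<le> h" shows "\<exists>xs. hs = map ((+) c) xs"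
  using assms by (intro exI[of _ "map (\<lambda>h. h - c) hs"]) (auto simp: map_idI)

text \<open>The two sets correspond to last height at least 2 and last height 1. Subtracting 2 from
  all other heights keeps descents and excess and lowers the first entry by 2, hence
  \<open>n - 2\<close>.\<close>

lemma admissible_lists_eq:
  assumes "m \<ge> 2" "n \<ge> 2"
  shows "admissible_lists m d n = map ((+) 2) ` lists_of_size m d (n - 2) \<union>
    (if d = 0 then {} else (\<lambda>xs. map ((+) 2) xs @ [1]) ` lists_of_size (m - 1) (d - 1) (n - 2))"
    (is "_ = ?U \<union> ?V")
proof (intro equalityI subsetI)
  fix hs assume "hs \<in> admissible_lists m d n"
  then have hs: "length hs = m" "descents hs = d" "hd hs + excess hs = n" "hs \<noteq> []"
      "\<forall>h\<in>set (butlast hs). 2 \<le> h" "1 \<le> last hs"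
    by (auto simp: admissible_lists_def lists_of_size_def admissible_def)
  have split: "hs = butlast hs @ [last hs]" using hs by simp
  show "hs \<in> ?U \<union> ?V"
  proof (cases "last hs = 1")
    case False
    then have "\<forall>h\<in>set hs. 2 \<le> h" using hs split
      by (metis One_nat_def Suc_1 Un_iff empty_iff insert_iff le_antisym list.set(1) list.set(2) not_less_eq_eq set_append)
    then obtain xs where xs: "hs = map ((+) 2) xs" using exists_map_add by blast
    then have "xs \<in> lists_of_size m d (n - 2)"
      using hs by (auto simp: lists_of_size_def descents_map_add excess_map_add hd_map)
    then show ?thesis using xs by blast
  next
    case True
    obtain xs where xs: "butlast hs = map ((+) 2) xs" using exists_map_add hs by blast
    then have eq: "hs = map ((+) 2) xs @ [1]" using True split by simp
    then have "xs \<noteq> []" using hs assms by auto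
    then have "d \<noteq> 0" "xs \<in> lists_of_size (m - 1) (d - 1) (n - 2)"
      using hs(1-3) unfolding eq
      by (auto simp: lists_of_size_def descents_snoc excess_snoc descents_map_add excess_map_add hd_map last_map)
    then show ?thesis using eq by auto
  qed
next
  fix hs assume "hs \<in> ?U \<union> ?V"
  then consider xs where "hs = map ((+) 2) xs" "xs \<in> lists_of_size m d (n - 2)"
    | xs where "d \<noteq> 0" "hs = map ((+) 2) xs @ [1]" "xs \<in> lists_of_size (m - 1) (d - 1) (n - 2)"
    by (auto split: if_splits)
  then show "hs \<in> admissible_lists m d n"
  proof cases
    case (1 xs)
    moreover from this have "xs \<noteq> []" using assms by (auto simp: lists_of_size_def)
    ultimately show ?thesis using assms
      by (auto simp: admissible_lists_def lists_of_size_def admissible_def descents_map_add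
          excess_map_add hd_map last_map dest!: in_set_butlastD)
  next
    case (2 xs)
    moreover from this have "xs \<noteq> []" using assms by (auto simp: lists_of_size_def)
    ultimately show ?thesis using assms
      by (auto simp: admissible_lists_def lists_of_size_def admissible_def descents_map_add
          excess_map_add descents_snoc excess_snoc hd_map last_map)
  qed
qed

lemma card_admissible_lists:
  assumes "m \<ge> 2" "n \<ge> 2"
  shows "finite (admissible_lists m d n) \<and> real (card (admissible_lists m d n)) =
    narayana m (d + 1) * real ((n - 2) choose (m - 1)) +
    narayana (m - 1) d * real ((n - 2) choose (m - 2))"
proof -
  define A where "A = lists_of_size m d (n - 2)"
  define B where "B = (if d = 0 then {} else lists_of_size (m - 1) (d - 1) (n - 2))"
  have A: "finite A" "real (card A) = narayana m (d + 1) * real ((n - 2) choose (m - 1))"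
    using card_lists_of_size[of m d "n - 2"] assms by (auto simp: A_def)
  \<comment> \<open>For \<open>d = 0\<close> the empty set agrees with
    \<open>narayana (m - 1) 0 = 0\<close>.\<close>
  have B: "finite B" "real (card B) = narayana (m - 1) d * real ((n - 2) choose (m - 2))"
    using card_lists_of_size[of "m - 1" "d - 1" "n - 2"] assms
    by (auto simp: B_def narayana_def[of _ 0] numeral_2_eq_2)
  have eq: "admissible_lists m d n = map ((+) 2) ` A \<union> (\<lambda>xs. map ((+) 2) xs @ [1]) ` B"
    using admissible_lists_eq[OF assms] by (simp add: A_def B_def)
  have disj: "map ((+) 2) ` A \<inter> (\<lambda>xs. map ((+) 2) xs @ [1]) ` B = {}"
  proof -
    have "map ((+) 2) xs \<noteq> map ((+) 2) ys @ [1]" for xs ys :: "nat list"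
    proof
      assume "map ((+) 2) xs = map ((+) 2) ys @ [1]"
      then have "1 \<in> set (map ((+) 2) xs)" by simp
      then show False by auto
    qed
    then show ?thesis by blast
  qed
  have inj: "inj_on (map ((+) (2::nat))) X" for X by (simp add: inj_on_def inj_map_eq_map)
  have "inj_on (\<lambda>xs. map ((+) (2::nat)) xs @ [1]) X" for X by (simp add: inj_on_def inj_map_eq_map)
  then have "card (admissible_lists m d n) = card A + card B"
    unfolding eq using A B disj inj by (simp add: card_Un_disjoint card_image)
  then show ?thesis using A B by (simp add: eq)
qed

theorem corollary4p2:
  "(\<forall>m n d :: nat. m \<ge> 2 \<and> n \<ge> 2 \<longrightarrow>
      finite {P \<in> fibonacci_polyominoes m n. des P = d} \<and>
      real (card {P \<in> fibonacci_polyominoes m n. des P = d}) =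
        narayana m (d + 1) * real ((n - 2) choose (m - 1)) +
        narayana (m - 1) d * real ((n - 2) choose (m - 2))) \<and>
   (\<forall>n :: nat. n \<ge> 1 \<longrightarrow>
      (\<exists>!P. P \<in> fibonacci_polyominoes 1 n) \<and>
      (\<forall>P \<in> fibonacci_polyominoes 1 n. des P = 0))"
proof (intro conjI allI impI ballI)
  fix m n d :: nat assume "m \<ge> 2 \<and> n \<ge> 2"
  then have card: "finite (admissible_lists m d n)" "real (card (admissible_lists m d n)) =
      narayana m (d + 1) * real ((n - 2) choose (m - 1)) +
      narayana (m - 1) d * real ((n - 2) choose (m - 2))"
    using card_admissible_lists by auto
  have "inj_on staircase_polyomino (admissible_lists m d n)"
    by (rule inj_on_subset[OF inj_on_staircase_polyomino]) (auto simp: admissible_lists_def)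
  then show "finite {P \<in> fibonacci_polyominoes m n. des P = d}"
    "real (card {P \<in> fibonacci_polyominoes m n. des P = d}) =
        narayana m (d + 1) * real ((n - 2) choose (m - 1)) +
        narayana (m - 1) d * real ((n - 2) choose (m - 2))"
    unfolding fibonacci_polyominoes_des_eq using card by (simp_all add: card_image)
next
  fix n :: nat assume n: "n \<ge> 1"
  then have "{hs. admissible hs \<and> length hs = 1 \<and> hd hs + excess hs = n} = {[n]}"
    by (auto simp: admissible_def length_Suc_conv)
  then have eq: "fibonacci_polyominoes 1 n = {staircase_polyomino [n]}"
    by (simp add: fibonacci_polyominoes_eq)
  then show "\<exists>!P. P \<in> fibonacci_polyominoes 1 n" by auto
  fix P assume "P \<in> fibonacci_polyominoes 1 n"
  with eq n show "des P = 0"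
    by (simp add: staircase_polyomino_simps admissible_def)
qed

end
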